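(* Let $h^{\alpha}$ be a stable string configuration. Let $h^{\beta}$ be a string configuration with $h^{\beta}_i \le h^{\alpha}_i$ for all $i$. Then the Variant Monte Carlo (VMC) algorithm started from $h^{\beta}$ cannot reach a configuration $h^{\gamma}$ with $h^{\gamma}_i > h^{\alpha}_i$ for some $i$.
   Context: Strings and energy. Fix an integer $L\ge 1$. A string (configuration) is an integer-valued function $h=(h_i)$ of a site index $i$, where the sites are $i=1,\dots,L$ with periodic boundary conditions (indices are taken modulo $L$, so $h_0=h_L$ and $h_{L+1}=h_1$). The string moves on a two-dimensional lattice in an arbitrary real-valued random (but fixed, time-independent) potential $V(i,h)$. Toroidal boundary conditions are used: $V$ is periodic in the height $h$, while the heights $h_i$ are recorded as integers without reduction modulo the period (so that the driving term $-f h_i$ keeps decreasing when the string winds around the torus in the forward direction). For a fixed real external driving force $f$, the energy of a string is $$E(h)=\sum_{i=1}^{L}\left[V(i,h_i)-f h_i+E_{\mathrm{el}}(|h_{i+1}-h_i|)\right],$$ where $E_{\mathrm{el}}$ is a real-valued convex elastic energy, in the sense that $x\mapsto E_{\mathrm{el}}(|x|)$ is convex on $\mathbb{R}$. Fronts. A forward front of length $k$ ($1\le k\le L$) of a string $h$ is a contiguous set of $k$ sites $i,i+1,\dots,i+k-1$ (modulo $L$) which move together in the forward direction: moving the front replaces $h_j$ by $h_j+1$ for each $j$ in the set, and leaves the other heights unchanged. A backward front is defined similarly, with $h_j$ replaced by $h_j-1$. A front is unstable if moving it strictly lowers the energy $E$, and stable otherwise. A string is stable (pinned) if it has no unstable front,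 forward or backward. VMC algorithm. At each time step, the VMC algorithm moves a single front whose length $k$ is minimal among the lengths of all unstable forward and backward fronts of the current string (if there are several unstable fronts of this minimal length, any one of them may be moved); if there is no unstable front, the string stays where it is. The force $f$ and the potential $V$ are fixed during the evolution. A configuration is reached by the algorithm from a starting configuration if it is obtained from it after some finite number of such steps, for some choices among unstable fronts of minimal length. *)

theory Defs
  imports "HOL-Analysis.Analysis"
begin

text \<open>
  Sites are integers taken modulo \<open>L\<close>: a string is an \<open>L\<close>-periodic function on the integers, with
  \<open>1, \<dots>, L\<close> as representatives of the sites.
\<close>

definition configuration :: "nat \<Rightarrow> (int \<Rightarrow> int) \<Rightarrow> bool" where
  "configuration L h \<longleftrightarrow> (\<forall>i. h (i + int L) = h i)"

text \<open>
  The potential is periodic in the height; the heights themselves are not reduced modulo that period.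
\<close>

definition toroidal :: "nat \<Rightarrow> (int \<Rightarrow> int \<Rightarrow> real) \<Rightarrow> bool" where
  "toroidal L V \<longleftrightarrow> (\<exists>P>0. \<forall>i\<in>{1..int L}. \<forall>x. V i (x + P) = V i x)"

definition convex_elastic :: "(real \<Rightarrow> real) \<Rightarrow> bool" where
  "convex_elastic Eel \<longleftrightarrow> convex_on UNIV (\<lambda>x::real. Eel \<bar>x\<bar>)"

definition energy ::
  "nat \<Rightarrow> (int \<Rightarrow> int \<Rightarrow> real) \<Rightarrow> (real \<Rightarrow> real) \<Rightarrow> real \<Rightarrow> (int \<Rightarrow> int) \<Rightarrow> real" where
  "energy L V Eel f h =
     (\<Sum>i\<in>{1..int L}. V i (h i) - f * real_of_int (h i) + Eel (real_of_int \<bar>h (i + 1) - h i\<bar>))"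

datatype direction = Forward | Backward

fun displacement :: "direction \<Rightarrow> int" where
  "displacement Forward = 1"
| "displacement Backward = -1"

text \<open>All integers congruent modulo \<open>L\<close> to one of \<open>i, i + 1, \<dots>, i + k - 1\<close>.\<close>

definition front_sites :: "nat \<Rightarrow> int \<Rightarrow> nat \<Rightarrow> int set" where
  "front_sites L i k = {j. \<exists>m<k. j mod int L = (i + int m) mod int L}"

definition move_front ::
  "nat \<Rightarrow> direction \<Rightarrow> int \<Rightarrow> nat \<Rightarrow> (int \<Rightarrow> int) \<Rightarrow> int \<Rightarrow> int" where
  "move_front L d i k h = (\<lambda>j. if j \<in> front_sites L i k then h j + displacement d else h j)"

definition unstable_front ::
  "nat \<Rightarrow> (int \<Rightarrow> int \<Rightarrow> real) \<Rightarrow> (real \<Rightarrow> real) \<Rightarrow> real \<Rightarrow> (int \<Rightarrow> int) \<Rightarrow>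
     direction \<Rightarrow> int \<Rightarrow> nat \<Rightarrow> bool" where
  "unstable_front L V Eel f h d i k \<longleftrightarrow>
     1 \<le> k \<and> k \<le> L \<and> energy L V Eel f (move_front L d i k h) < energy L V Eel f h"

definition stable_string ::
  "nat \<Rightarrow> (int \<Rightarrow> int \<Rightarrow> real) \<Rightarrow> (real \<Rightarrow> real) \<Rightarrow> real \<Rightarrow> (int \<Rightarrow> int) \<Rightarrow> bool" where
  "stable_string L V Eel f h \<longleftrightarrow> \<not> (\<exists>d i k. unstable_front L V Eel f h d i k)"

definition vmc_step ::
  "nat \<Rightarrow> (int \<Rightarrow> int \<Rightarrow> real) \<Rightarrow> (real \<Rightarrow> real) \<Rightarrow> real \<Rightarrow> (int \<Rightarrow> int) \<Rightarrow> (int \<Rightarrow> int) \<Rightarrow> bool" where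
  "vmc_step L V Eel f h h' \<longleftrightarrow>
     (\<exists>d i k. unstable_front L V Eel f h d i k
        \<and> (\<forall>d' i' k'. unstable_front L V Eel f h d' i' k' \<longrightarrow> k \<le> k')
        \<and> h' = move_front L d i k h)
     \<or> (stable_string L V Eel f h \<and> h' = h)"

definition vmc_reaches ::
  "nat \<Rightarrow> (int \<Rightarrow> int \<Rightarrow> real) \<Rightarrow> (real \<Rightarrow> real) \<Rightarrow> real \<Rightarrow> (int \<Rightarrow> int) \<Rightarrow> (int \<Rightarrow> int) \<Rightarrow> bool" where
  "vmc_reaches L V Eel f = (vmc_step L V Eel f)\<^sup>*\<^sup>*"

end

(*
  With c x = Eel |x| convex, the energy is submodular on the lattice of heights. Suppose that a
  string h below the pinned string g moves a front F forward beyond g, and let S be the set of sites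
  of F where h = g. Submodularity for h + 1_F and g gives
  E (g + 1_S) + E (h + 1_(F - S)) <= E (h + 1_F) + E g < E h + E g.
  Maximal runs of consecutive sites are separated by at least one site, so the energy changes of
  their moves add up. Since g is pinned, moving S costs no less than zero, so moving F - S lowers the
  energy of h, and hence so does moving one of its runs. That run is a shorter unstable front than F,
  against the choice of F.
*)
theory Submission imports Defs
begin

section \<open>Submodularity of the energy\<close>

lemma convex_on_UNIV_add_le:
  fixes c :: "real \<Rightarrow> real"
  assumes c: "convex_on UNIV c" and x: "x \<le> u" "x \<le> v" and sum: "u + v = x + y"
  shows "c u + c v \<le> c x + c y"
proof (cases "x = y")
  case True
  with x sum have "u = x" "v = x" by linarith+
  with True show ?thesis by simp
next
  case False
  with x sum have xy: "x < y" by linarith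
  \<comment> \<open>The points \<open>u\<close> and \<open>v\<close> are mirror images in the
    midpoint of \<open>[x, y]\<close>, so \<open>v\<close> is the convex combination with the two
    weights of \<open>u\<close> exchanged.\<close>
  define t where "t = (u - x) / (y - x)"
  have t: "0 \<le> t" "t \<le> 1" using x sum xy by (auto simp: t_def divide_simps)
  have "t * (y - x) = u - x" using xy by (simp add: t_def)
  then have u: "u = (1 - t) * x + t * y" by (simp add: algebra_simps)
  then have v: "v = (1 - (1 - t)) * x + (1 - t) * y" using sum by (simp add: algebra_simps)
  have "c u \<le> (1 - t) * c x + t * c y"
    unfolding u using convex_onD[OF c t, of x y] by simp
  moreover have "c v \<le> (1 - (1 - t)) * c x + (1 - t) * c y"
    unfolding v using convex_onD[OF c, of "1 - t" x y] t by simp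
  ultimately show ?thesis by (simp add: algebra_simps)
qed

text \<open>If both ends of the link are ordered alike, \<open>max\<close> and \<open>min\<close>
  only permute the two strings and equality holds. If the strings cross on the link, the new
  differences have the same sum as the old ones and lie between them, so convexity applies.\<close>

lemma elastic_submodular:
  fixes a b p q :: int
  assumes "convex_elastic Eel"
  shows "Eel (real_of_int \<bar>max b q - max a p\<bar>) + Eel (real_of_int \<bar>min b q - min a p\<bar>)
    \<le> Eel (real_of_int \<bar>b - a\<bar>) + Eel (real_of_int \<bar>q - p\<bar>)"
proof -
  have c: "convex_on UNIV (\<lambda>x::real. Eel \<bar>x\<bar>)"
    using assms by (simp add: convex_elastic_def)
  consider "a \<le> p" "b \<le> q" | "p \<le> a" "q \<le> b" | "p \<le> a" "b \<le> q" | "a \<le> p" "q \<le> b"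
    by linarith
  then show ?thesis
  proof cases
    case 3
    then show ?thesis
      using convex_on_UNIV_add_le[OF c, of "b - a" "q - a" "b - p" "q - p"]
      by (simp add: max_def min_def)
  next
    case 4
    then show ?thesis
      using convex_on_UNIV_add_le[OF c, of "q - p" "b - p" "q - a" "b - a"]
      by (simp add: max_def min_def)
  qed (simp_all add: max_def min_def)
qed

text \<open>The potential and the driving term see one height at a time, so there \<open>max\<close>
  and \<open>min\<close> merely exchange summands. Only the elastic terms can give a strict
  inequality.\<close>

lemma energy_submodular:
  assumes "convex_elastic Eel"
  shows "energy L V Eel f (\<lambda>j. max (h j) (g j)) + energy L V Eel f (\<lambda>j. min (h j) (g j))
    \<le> energy L V Eel f h + energy L V Eel f g"
  unfolding energy_def sum.distrib[symmetric]
proof (rule sum_mono)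
  fix i
  have "V i (max (h i) (g i)) - f * real_of_int (max (h i) (g i))
      + (V i (min (h i) (g i)) - f * real_of_int (min (h i) (g i)))
    = V i (h i) - f * real_of_int (h i) + (V i (g i) - f * real_of_int (g i))"
    by (simp add: max_def min_def)
  with elastic_submodular[OF assms, of "h (i + 1)" "g (i + 1)" "h i" "g i"]
  show "V i (max (h i) (g i)) - f * real_of_int (max (h i) (g i))
      + Eel (real_of_int \<bar>max (h (i + 1)) (g (i + 1)) - max (h i) (g i)\<bar>)
      + (V i (min (h i) (g i)) - f * real_of_int (min (h i) (g i))
      + Eel (real_of_int \<bar>min (h (i + 1)) (g (i + 1)) - min (h i) (g i)\<bar>))
    \<le> V i (h i) - f * real_of_int (h i) + Eel (real_of_int \<bar>h (i + 1) - h i\<bar>)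
      + (V i (g i) - f * real_of_int (g i) + Eel (real_of_int \<bar>g (i + 1) - g i\<bar>))"
    by linarith
qed

text \<open>The sites where a front touches the pinned string, and those where it does not, need not
  be contiguous, so forward moves of arbitrary sets are needed.\<close>

definition advance :: "int set \<Rightarrow> (int \<Rightarrow> int) \<Rightarrow> int \<Rightarrow> int" where
  "advance A h = (\<lambda>j. if j \<in> A then h j + 1 else h j)"

lemma move_front_Forward: "move_front L Forward i k h = advance (front_sites L i k) h"
  by (auto simp: move_front_def advance_def)

text \<open>The gaps ensure that each link from \<open>i\<close> to \<open>i + 1\<close> meets at
  most one of the two sets, so no elastic term couples the moves.\<close>

lemma energy_advance_Un:
  assumes "\<And>j. j \<in> A \<Longrightarrow> j \<notin> B \<and> j + 1 \<notin> B" and "\<And>j. j \<in> B \<Longrightarrow> j + 1 \<notin> A"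
  shows "energy L V Eel f (advance (A \<union> B) h) + energy L V Eel f h
    = energy L V Eel f (advance A h) + energy L V Eel f (advance B h)"
  unfolding energy_def sum.distrib[symmetric]
proof (rule sum.cong)
  fix i
  consider "i \<notin> A" "i + 1 \<notin> A" | "i \<notin> B" "i + 1 \<notin> B"
    using assms by blast
  then show "V i (advance (A \<union> B) h i) - f * real_of_int (advance (A \<union> B) h i)
      + Eel (real_of_int \<bar>advance (A \<union> B) h (i + 1) - advance (A \<union> B) h i\<bar>)
      + (V i (h i) - f * real_of_int (h i) + Eel (real_of_int \<bar>h (i + 1) - h i\<bar>))
    = V i (advance A h i) - f * real_of_int (advance A h i)
      + Eel (real_of_int \<bar>advance A h (i + 1) - advance A h i\<bar>)
      + (V i (advance B h i) - f * real_of_int (advance B h i)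
      + Eel (real_of_int \<bar>advance B h (i + 1) - advance B h i\<bar>))"
    by cases (simp_all add: advance_def)
qed simp

section \<open>Periodic site sets and their size\<close>

lemma configuration_cong:
  assumes "configuration L h" and "i mod int L = j mod int L"
  shows "h i = h j"
proof -
  have "h (i + int L * int n) = h i" for i n
  proof (induction n)
    case (Suc n)
    have "h (i + int L * int (Suc n)) = h (i + int L * int n + int L)"
      by (simp add: algebra_simps)
    with Suc assms(1) show ?case by (simp add: configuration_def)
  qed simp
  then have shift: "h (i + int L * z) = h i" for i z
    by (cases z rule: int_cases2) (metis, metis add_uminus_conv_diff diff_add_cancel mult_minus_right)
  obtain z where "i = j + int L * z"
    using assms(2) by (metis mod_eqE)
  then show ?thesis by (simp add: shift)
qed

text \<open>A site is represented by its whole residue class, so a set of sites is a union of such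
  classes.\<close>

definition periodic_sites :: "nat \<Rightarrow> int set \<Rightarrow> bool" where
  "periodic_sites L A \<longleftrightarrow> (\<forall>i j. i mod int L = j mod int L \<longrightarrow> i \<in> A \<longrightarrow> j \<in> A)"

lemma periodic_sitesD:
  "periodic_sites L A \<Longrightarrow> i mod int L = j mod int L \<Longrightarrow> i \<in> A \<longleftrightarrow> j \<in> A"
  unfolding periodic_sites_def by metis

lemma periodic_sites_front: "periodic_sites L (front_sites L i k)"
  by (auto simp: periodic_sites_def front_sites_def)

lemma periodic_sites_Diff:
  "periodic_sites L A \<Longrightarrow> periodic_sites L B \<Longrightarrow> periodic_sites L (A - B)"
  unfolding periodic_sites_def by (metis Diff_iff)

lemma configuration_move_front:
  assumes "configuration L h"
  shows "configuration L (move_front L d i k h)"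
  using assms by (auto simp: configuration_def move_front_def front_sites_def)

text \<open>For \<open>L >= 1\<close> a nonempty periodic set is infinite; its sites are counted
  through their residues.\<close>

definition residues_of :: "nat \<Rightarrow> int set \<Rightarrow> int set" where
  "residues_of L A = (\<lambda>j. j mod int L) ` A"

lemma finite_residues_of:
  assumes "L \<ge> 1"
  shows "finite (residues_of L A)"
  by (rule finite_subset[of _ "{0..<int L}"]) (use assms in \<open>auto simp: residues_of_def\<close>)

lemma residues_of_psubset:
  assumes "periodic_sites L A" "A \<subset> B"
  shows "residues_of L A \<subset> residues_of L B"
proof -
  obtain b where b: "b \<in> B" "b \<notin> A" using assms(2) by blast
  have "b mod int L \<notin> residues_of L A"
    using b(2) periodic_sitesD[OF assms(1)] unfolding residues_of_def by blast
  then show ?thesis using b(1) assms(2) by (auto simp: residues_of_def)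
qed

lemma card_residues_of_psubset:
  assumes "L \<ge> 1" "periodic_sites L A" "A \<subset> B"
  shows "card (residues_of L A) < card (residues_of L B)"
  using assms by (intro psubset_card_mono finite_residues_of residues_of_psubset)

text \<open>As \<open>k <= L\<close>, a front does not wrap onto itself. Its length can thus be read
  off its set of sites, and strict inclusion of fronts becomes strict inequality of lengths.\<close>

lemma card_residues_of_front:
  assumes "k \<le> L"
  shows "card (residues_of L (front_sites L i k)) = k"
proof -
  have "residues_of L (front_sites L i k) = (\<lambda>m. (i + int m) mod int L) ` {..<k}"
  proof
    show "residues_of L (front_sites L i k) \<subseteq> (\<lambda>m. (i + int m) mod int L) ` {..<k}"
      unfolding residues_of_def front_sites_def by blast
    have "i + int m \<in> front_sites L i k" if "m < k" for m
      using that unfolding front_sites_def by blast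
    then show "(\<lambda>m. (i + int m) mod int L) ` {..<k} \<subseteq> residues_of L (front_sites L i k)"
      unfolding residues_of_def by blast
  qed
  moreover have "inj_on (\<lambda>m. (i + int m) mod int L) {..<k}"
  proof (rule inj_onI)
    fix m n assume mn: "m \<in> {..<k}" "n \<in> {..<k}"
      and "(i + int m) mod int L = (i + int n) mod int L"
    then have "int L dvd int m - int n"
      by (simp add: mod_eq_dvd_iff)
    moreover have "\<bar>int m - int n\<bar> < int L" using mn assms by auto
    ultimately show "m = n" using dvd_imp_le_int[of "int m - int n" "int L"] by fastforce
  qed
  ultimately show ?thesis by (simp add: card_image)
qed

section \<open>Extracting an unstable front from a move that lowers the energy\<close>

lemma front_sites_full:
  assumes "L \<ge> 1"
  shows "front_sites L 0 L = UNIV"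
proof -
  have "\<exists>m<L. j mod int L = int m mod int L" for j
    by (rule exI[of _ "nat (j mod int L)"]) (use assms in \<open>auto simp: nat_less_iff\<close>)
  then show ?thesis by (auto simp: front_sites_def)
qed

text \<open>The front below is a maximal run of consecutive sites of \<open>A\<close>.\<close>

lemma separated_front:
  assumes L: "L \<ge> 1" and A: "periodic_sites L A" and ne: "A \<noteq> {}" and "A \<noteq> UNIV"
  obtains a k where "1 \<le> k" "k \<le> L" "front_sites L a k \<subseteq> A"
    "\<forall>j \<in> front_sites L a k. j + 1 \<notin> A - front_sites L a k"
    "\<forall>j \<in> A - front_sites L a k. j + 1 \<notin> front_sites L a k"
proof -
  obtain z where z: "z \<notin> A" using \<open>A \<noteq> UNIV\<close> by blast
  obtain b where b: "b \<in> A" using ne by blast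
  \<comment> \<open>Scanning upwards from the gap \<open>z\<close> meets a representative of
    \<open>b\<close>. The first hit \<open>a\<close> then has its predecessor outside
    \<open>A\<close>.\<close>
  have "(z + int (nat ((b - z) mod int L))) mod int L = b mod int L"
    using L by (simp add: mod_simps)
  then have ex: "\<exists>n. z + int n \<in> A" using b periodic_sitesD[OF A] by blast
  define n where "n = (LEAST n. z + int n \<in> A)"
  have n: "z + int n \<in> A" unfolding n_def by (rule LeastI_ex[OF ex])
  have "n \<noteq> 0" using n z by (metis add.right_neutral of_nat_0)
  define a where "a = z + int n"
  have a: "a \<in> A" using n by (simp add: a_def)
  have "z + int (n - 1) \<notin> A"
    using \<open>n \<noteq> 0\<close> not_less_Least[of "n - 1" "\<lambda>n. z + int n \<in> A"] by (simp add: n_def)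
  moreover have "z + int (n - 1) = a - 1" using \<open>n \<noteq> 0\<close> by (simp add: a_def of_nat_diff)
  ultimately have a1: "a - 1 \<notin> A" by simp
  \<comment> \<open>Going around the ring, \<open>a + (L - 1)\<close> is the same site as
    \<open>a - 1\<close>, so the run starting at \<open>a\<close> ends after at most
    \<open>L - 1\<close> sites.\<close>
  have "(a + int (L - 1)) mod int L = (a - 1 + int L) mod int L" 
    using L by (simp add: of_nat_diff algebra_simps)
  also have "\<dots> = (a - 1) mod int L" by (rule mod_add_self2)
  finally have last: "a + int (L - 1) \<notin> A"
    using a1 periodic_sitesD[OF A] by blast
  define k where "k = (LEAST k. a + int k \<notin> A)"
  have k: "a + int k \<notin> A" unfolding k_def by (rule LeastI[of "\<lambda>k. a + int k \<notin> A", OF last])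
  have kL: "k \<le> L - 1" unfolding k_def by (rule Least_le[of "\<lambda>k. a + int k \<notin> A", OF last])
  have below: "a + int m \<in> A" if "m < k" for m
    using that not_less_Least[of m "\<lambda>k. a + int k \<notin> A"] by (simp add: k_def)
  have "k \<noteq> 0" using k a by (metis add.right_neutral of_nat_0)
  show thesis
  proof
    show "1 \<le> k" "k \<le> L" using \<open>k \<noteq> 0\<close> kL by auto
    show "front_sites L a k \<subseteq> A"
      using below periodic_sitesD[OF A] unfolding front_sites_def by blast
    show "\<forall>j \<in> front_sites L a k. j + 1 \<notin> A - front_sites L a k"
    proof
      fix j assume j: "j \<in> front_sites L a k"
      obtain m where m: "m < k" "j mod int L = (a + int m) mod int L"
        using j by (auto simp: front_sites_def)
      have m1: "(j + 1) mod int L = (a + int (Suc m)) mod int L"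
        using mod_add_cong[OF m(2) refl, of 1] by (simp add: algebra_simps)
      show "j + 1 \<notin> A - front_sites L a k"
      proof (cases "Suc m < k")
        case True
        then have "j + 1 \<in> front_sites L a k"
          unfolding front_sites_def using m1 by blast
        then show ?thesis by simp
      next
        \<comment> \<open>Here \<open>j\<close> is the last site of the run, and its successor is
          congruent to \<open>a + k\<close>.\<close>
        case False
        with m(1) have "Suc m = k" by simp
        then show ?thesis using k periodic_sitesD[OF A m1] by simp
      qed
    qed
    show "\<forall>j \<in> A - front_sites L a k. j + 1 \<notin> front_sites L a k"
    proof (intro ballI notI)
      fix j assume j: "j \<in> A - front_sites L a k" and "j + 1 \<in> front_sites L a k"
      then obtain m where m: "m < k" "(j + 1) mod int L = (a + int m) mod int L"
        by (auto simp: front_sites_def)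
      have m1: "j mod int L = (a + int m - 1) mod int L"
        using mod_diff_cong[OF m(2) refl, of 1] by simp
      show False
      proof (cases m)
        \<comment> \<open>Here \<open>j\<close> is congruent to \<open>a - 1\<close>, the gap just
          before the run.\<close>
        case 0
        then show False using a1 j periodic_sitesD[OF A m1] by simp
      next
        case (Suc m')
        then have "j \<in> front_sites L a k"
          using m(1) m1 by (auto simp: front_sites_def algebra_simps intro!: exI[of _ m'])
        then show False using j by simp
      qed
    qed
  qed
qed

text \<open>Induction on the number of sites: a run is split off from \<open>A\<close>, and since
  the energy changes add up, the run or the smaller remainder lowers the energy. Keeping the front
  inside \<open>A\<close> is what later bounds its length.\<close>

lemma unstable_front_of_advance:
  assumes L: "L \<ge> 1" and "periodic_sites L A"
    and "energy L V Eel f (advance A h) < energy L V Eel f h"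
  shows "\<exists>i k. front_sites L i k \<subseteq> A \<and> unstable_front L V Eel f h Forward i k"
  using assms(2,3)
proof (induction "card (residues_of L A)" arbitrary: A rule: less_induct)
  case less
  have "A \<noteq> {}" using less.prems(2) by (auto simp: advance_def)
  show ?case
  proof (cases "A = UNIV")
    \<comment> \<open>The full ring has no gap to delimit a run, but it is itself a front of length
      \<open>L\<close>.\<close>
    case True
    then have "front_sites L 0 L \<subseteq> A \<and> unstable_front L V Eel f h Forward 0 L"
      using L less.prems(2) by (simp add: unstable_front_def move_front_Forward front_sites_full)
    then show ?thesis by blast
  next
    case False
    obtain a k where ak: "1 \<le> k" "k \<le> L" "front_sites L a k \<subseteq> A"
      "\<forall>j \<in> front_sites L a k. j + 1 \<notin> A - front_sites L a k"
      "\<forall>j \<in> A - front_sites L a k. j + 1 \<notin> front_sites L a k"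
      using separated_front[OF L less.prems(1) \<open>A \<noteq> {}\<close> False] by metis
    define F where "F = front_sites L a k"
    have "a \<in> F" using ak(1) by (auto simp: F_def front_sites_def intro!: exI[of _ 0])
    have split: "energy L V Eel f (advance A h) + energy L V Eel f h
      = energy L V Eel f (advance F h) + energy L V Eel f (advance (A - F) h)"
      using energy_advance_Un[of F "A - F" L V Eel f h] ak(3-5)
      by (auto simp: F_def Un_absorb1)
    show ?thesis
    proof (cases "energy L V Eel f (advance F h) < energy L V Eel f h")
      case True
      then have "unstable_front L V Eel f h Forward a k"
        using ak by (simp add: unstable_front_def move_front_Forward F_def)
      then show ?thesis using ak(3) by blast
    next
      case False
      have per: "periodic_sites L (A - F)"
        using less.prems(1) periodic_sites_front F_def by (simp add: periodic_sites_Diff)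
      have "A - F \<subset> A" using \<open>a \<in> F\<close> ak(3) F_def by blast
      then have "card (residues_of L (A - F)) < card (residues_of L A)"
        by (rule card_residues_of_psubset[OF L per])
      moreover have "energy L V Eel f (advance (A - F) h) < energy L V Eel f h"
        using split False less.prems(2) by linarith
      ultimately show ?thesis using less.hyps[OF _ per] by blast
    qed
  qed
qed

section \<open>A minimal unstable front does not pass a pinned string\<close>

lemma minimal_front_no_passing:
  assumes L: "L \<ge> 1" and conv: "convex_elastic Eel"
    and g: "configuration L g" "stable_string L V Eel f g"
    and h: "configuration L h" "\<And>i. h i \<le> g i"
    and unst: "unstable_front L V Eel f h Forward i k"
    and min: "\<And>d' i' k'. unstable_front L V Eel f h d' i' k' \<Longrightarrow> k \<le> k'"
  shows "move_front L Forward i k h j \<le> g j"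
proof (rule ccontr)
  assume passed: "\<not> ?thesis"
  define F where "F = front_sites L i k"
  define S where "S = {j \<in> F. h j = g j}"
  \<comment> \<open>A unit step can pass \<open>g\<close> only where \<open>h\<close> touches it.
    This site later makes the inclusion of fronts strict.\<close>
  have "j \<in> S"
    using passed h(2)[of j] by (auto simp: move_front_Forward advance_def S_def F_def split: if_splits)
  have perS: "periodic_sites L S"
    unfolding periodic_sites_def
  proof (intro allI impI)
    fix p q assume pq: "p mod int L = q mod int L" "p \<in> S"
    then show "q \<in> S"
      using periodic_sitesD[OF periodic_sites_front pq(1), of i k]
        configuration_cong[OF g(1) pq(1)] configuration_cong[OF h(1) pq(1)]
      by (simp add: S_def F_def)
  qed
  have perD: "periodic_sites L (F - S)"
    using perS periodic_sites_front F_def by (simp add: periodic_sites_Diff)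
  \<comment> \<open>Heights are integers, so on \<open>F - S\<close>, where \<open>h < g\<close>,
    the moved string is still at most \<open>g\<close>.\<close>
  have max: "(\<lambda>j. max (advance F h j) (g j)) = advance S g"
  proof
    fix j show "max (advance F h j) (g j) = advance S g j"
      using h(2)[of j] by (auto simp: advance_def S_def max_def)
  qed
  have min': "(\<lambda>j. min (advance F h j) (g j)) = advance (F - S) h"
  proof
    fix j show "min (advance F h j) (g j) = advance (F - S) h j"
      using h(2)[of j] by (auto simp: advance_def S_def min_def)
  qed
  have "energy L V Eel f (advance S g) + energy L V Eel f (advance (F - S) h)
    \<le> energy L V Eel f (advance F h) + energy L V Eel f g"
    using energy_submodular[OF conv, of L V f "advance F h" g] by (simp add: max min')
  \<comment> \<open>Stability of \<open>g\<close> speaks of fronts only; splitting into runs extends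
    it to the set \<open>S\<close>.\<close>
  moreover have "energy L V Eel f g \<le> energy L V Eel f (advance S g)"
    using unstable_front_of_advance[OF L perS] g(2) unfolding stable_string_def
    by (meson not_le)
  moreover have "energy L V Eel f (advance F h) < energy L V Eel f h"
    using unst by (simp add: unstable_front_def move_front_Forward F_def)
  ultimately have "energy L V Eel f (advance (F - S) h) < energy L V Eel f h"
    by linarith
  then obtain i' k' where sub: "front_sites L i' k' \<subseteq> F - S"
    and unst': "unstable_front L V Eel f h Forward i' k'"
    using unstable_front_of_advance[OF L perD] by blast
  have "front_sites L i' k' \<subset> front_sites L i k"
    using sub \<open>j \<in> S\<close> by (auto simp: F_def S_def)
  from card_residues_of_psubset[OF L periodic_sites_front this]
  have "k' < k"
    using unst unst' by (simp add: unstable_front_def card_residues_of_front)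
  with min[OF unst'] show False by simp
qed

text \<open>Periodicity of the string is carried along as part of the invariant, because the contact
  set \<open>S\<close> must be a set of sites modulo \<open>L\<close>. Backward moves only lower
  heights.\<close>

lemma vmc_step_no_passing:
  assumes L: "L \<ge> 1" and conv: "convex_elastic Eel"
    and g: "configuration L g" "stable_string L V Eel f g"
    and h: "configuration L h" "\<And>i. h i \<le> g i"
    and step: "vmc_step L V Eel f h h'"
  shows "configuration L h' \<and> (\<forall>i. h' i \<le> g i)"
proof -
  consider "h' = h" | d i k where "unstable_front L V Eel f h d i k"
    "\<And>d' i' k'. unstable_front L V Eel f h d' i' k' \<Longrightarrow> k \<le> k'"
    "h' = move_front L d i k h"
    using step unfolding vmc_step_def by blast
  then show ?thesis
  proof cases
    case 1
    then show ?thesis using h by simp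
  next
    case 2
    have "h' j \<le> g j" for j
    proof (cases d)
      case Forward
      with 2 show ?thesis using minimal_front_no_passing[OF L conv g h] by blast
    next
      case Backward
      have "h' j \<le> h j" using 2(3) Backward by (simp add: move_front_def)
      then show ?thesis using h(2)[of j] by linarith
    qed
    then show ?thesis using 2(3) configuration_move_front[OF h(1)] by blast
  qed
qed

theorem theorem1:
  fixes L :: nat
    and V :: "int \<Rightarrow> int \<Rightarrow> real"
    and Eel :: "real \<Rightarrow> real"
    and f :: real
    and h\<alpha> h\<beta> :: "int \<Rightarrow> int"
  assumes "L \<ge> 1"
    and "toroidal L V"
    and "convex_elastic Eel"
    and "configuration L h\<alpha>"
    and "stable_string L V Eel f h\<alpha>"
    and "configuration L h\<beta>"
    and "\<forall>i. h\<beta> i \<le> h\<alpha> i"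
  shows "\<not> (\<exists>h\<gamma>. vmc_reaches L V Eel f h\<beta> h\<gamma> \<and> (\<exists>i. h\<gamma> i > h\<alpha> i))"
proof -
  have "configuration L h\<gamma> \<and> (\<forall>i. h\<gamma> i \<le> h\<alpha> i)" if "vmc_reaches L V Eel f h\<beta> h\<gamma>" for h\<gamma>
    using that unfolding vmc_reaches_def
  proof (induction rule: rtranclp_induct)
    case base
    then show ?case using assms(6,7) by blast
  next
    case (step h h')
    then show ?case using vmc_step_no_passing[OF assms(1,3,4,5)] by blast
  qed
  then show ?thesis by (meson not_le)
qed

end
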